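(* Let $V$ be a semi-normed real vector space and let $\mathcal{N}_V=\{\|\cdot\|:V\to\mathbb{R}\;;\;\|\cdot\|\text{ is a semi-norm on }V\}$. Then $(\mathcal{N}_V,+,\cdot)$ is a semi-vector space over $\mathbb{R}_0^+$, where $+$ is pointwise addition and $\cdot$ is pointwise multiplication by scalars in $\mathbb{R}_0^+$.
   Context: $\mathbb{R}_0^+=[0,\infty)$. A semi-norm on a real vector space $V$ is a function $\|\cdot\|:V\to\mathbb{R}$ with $\|v\|\ge 0$, $\|\alpha v\|=|\alpha|\|v\|$ and $\|u+v\|\le\|u\|+\|v\|$ for all $u,v\in V$, $\alpha\in\mathbb{R}$. A semi-vector space over $\mathbb{R}_0^+$ is a set $S$ with operations $+:S\times S\to S$ and $\cdot:\mathbb{R}_0^+\times S\to S$ such that: (1) $(S,+)$ is an abelian monoid satisfying the cancellation law $u+v=u+w\Rightarrow v=w$; (2) $\alpha(u+v)=\alpha u+\alpha v$; (3) $(\alpha+\beta)v=\alpha v+\beta v$; (4) $(\alpha\beta)v=\alpha(\beta v)$; (5) $1v=v$. *)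

theory Defs
  imports Complex_Main "HOL-Algebra.Group"
begin

definition semi_norm :: "('v::real_vector \<Rightarrow> real) \<Rightarrow> bool" where
  "semi_norm p \<longleftrightarrow>
     (\<forall>v. p v \<ge> 0) \<and>
     (\<forall>\<alpha> v. p (\<alpha> *\<^sub>R v) = \<bar>\<alpha>\<bar> * p v) \<and>
     (\<forall>u v. p (u + v) \<le> p u + p v)"

definition semi_norms :: "('v::real_vector \<Rightarrow> real) set" where
  "semi_norms = {p. semi_norm p}"

text \<open>The structure consists only of the carrier \<open>S\<close> and the two operations: the neutral
  element of the monoid is asserted to exist. The scalars in $[0,\infty)$ are rendered as
  real numbers \<open>\<alpha> \<ge> 0\<close>; \<open>smult\<close> at negative scalars is unconstrained.\<close>

locale semi_vector_space =
  fixes S :: "'a set"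
    and add :: "'a \<Rightarrow> 'a \<Rightarrow> 'a"  (infixl \<open>\<boxplus>\<close> 65)
    and smult :: "real \<Rightarrow> 'a \<Rightarrow> 'a"  (infixr \<open>\<odot>\<close> 75)
  assumes comm_monoid: "\<exists>e. comm_monoid \<lparr>carrier = S, monoid.mult = (\<boxplus>), one = e\<rparr>"
    and cancel: "\<lbrakk>u \<in> S; v \<in> S; w \<in> S; u \<boxplus> v = u \<boxplus> w\<rbrakk> \<Longrightarrow> v = w"
    and smult_closed: "\<lbrakk>\<alpha> \<ge> 0; v \<in> S\<rbrakk> \<Longrightarrow> \<alpha> \<odot> v \<in> S"
    and smult_add_right: "\<lbrakk>\<alpha> \<ge> 0; u \<in> S; v \<in> S\<rbrakk> \<Longrightarrow> \<alpha> \<odot> (u \<boxplus> v) = \<alpha> \<odot> u \<boxplus> \<alpha> \<odot> v"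
    and smult_add_left: "\<lbrakk>\<alpha> \<ge> 0; \<beta> \<ge> 0; v \<in> S\<rbrakk> \<Longrightarrow> (\<alpha> + \<beta>) \<odot> v = \<alpha> \<odot> v \<boxplus> \<beta> \<odot> v"
    and smult_assoc: "\<lbrakk>\<alpha> \<ge> 0; \<beta> \<ge> 0; v \<in> S\<rbrakk> \<Longrightarrow> (\<alpha> * \<beta>) \<odot> v = \<alpha> \<odot> (\<beta> \<odot> v)"
    and smult_one: "v \<in> S \<Longrightarrow> 1 \<odot> v = v"

end

theory Submission
  imports Defs
begin

text \<open>Real functions on V form a vector space under pointwise operations, so the equational
  axioms and cancellation are inherited. It remains to see that the semi-norms form a convex cone in
  it: \<open>semi_norm_zero\<close>, \<open>semi_norm_add\<close>,
  \<open>semi_norm_scale\<close>.\<close>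

lemma semi_norm_zero: "semi_norm (\<lambda>_. 0)"
  by (simp add: semi_norm_def)

lemma semi_norm_add:
  assumes "semi_norm f" "semi_norm g"
  shows "semi_norm (\<lambda>v. f v + g v)"
  unfolding semi_norm_def
proof (intro conjI allI)
  fix u v
  have "f (u + v) \<le> f u + f v" "g (u + v) \<le> g u + g v"
    using assms by (auto simp: semi_norm_def)
  then show "f (u + v) + g (u + v) \<le> f u + g u + (f v + g v)"
    by linarith
qed (use assms in \<open>auto simp: semi_norm_def distrib_left\<close>)

text \<open>The sign of \<open>\<alpha>\<close> matters twice: it keeps values nonnegative and
  preserves the direction of the triangle inequality.\<close>

lemma semi_norm_scale:
  assumes "\<alpha> \<ge> 0" "semi_norm f"
  shows "semi_norm (\<lambda>v. \<alpha> * f v)"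
  unfolding semi_norm_def
proof (intro conjI allI)
  fix u v
  have "f (u + v) \<le> f u + f v"
    using assms by (auto simp: semi_norm_def)
  then show "\<alpha> * f (u + v) \<le> \<alpha> * f u + \<alpha> * f v"
    using assms(1) by (metis distrib_left mult_left_mono)
qed (use assms in \<open>auto simp: semi_norm_def\<close>)

text \<open>The zero function supplies the neutral element that \<open>semi_vector_space\<close>
  asks to exist.\<close>

lemma comm_monoid_semi_norms:
  "comm_monoid \<lparr>carrier = semi_norms :: ('v::real_vector \<Rightarrow> real) set,
     monoid.mult = (\<lambda>f g v. f v + g v), one = (\<lambda>_. 0)\<rparr>"
  by (rule comm_monoidI)
    (auto simp: semi_norms_def semi_norm_zero semi_norm_add add.assoc add.commute)

theorem theorem3p10:
  fixes p :: "'v::real_vector \<Rightarrow> real"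
  assumes "semi_norm p"
  shows "semi_vector_space (semi_norms :: ('v \<Rightarrow> real) set)
           (\<lambda>f g v. f v + g v) (\<lambda>\<alpha> f v. \<alpha> * f v)"
proof
  show "\<exists>e. comm_monoid \<lparr>carrier = semi_norms :: ('v \<Rightarrow> real) set,
     monoid.mult = (\<lambda>f g v. f v + g v), one = e\<rparr>"
    using comm_monoid_semi_norms by blast
\<comment> \<open>By extensionality, everything but closure under scaling becomes real arithmetic at
  each vector.\<close>
qed (auto simp: semi_norms_def semi_norm_scale fun_eq_iff algebra_simps)

end
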